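(* Let $n,k\ge1$ and $t\ge1$ be integers and let $\mathcal{A}\subset 2^{[n]}$ be a family all of whose members have at most $k$ elements. Let $\mathcal{F}\subset\mathcal{A}$ be $t$-intersecting. Let $q,\tau\ge1$ and suppose $\mathcal{A}$ is $(r_0,q)$-spread for some $r_0$ with $r_0\ge 2\tau q$ and $r_0>2^{12}\tau\log_2(2k)$. Then there exist a $t$-intersecting family $\mathcal{S}$ of sets of size at most $q$ and a family $\mathcal{F}'\subset\mathcal{F}$ such that: (i) every set in $\mathcal{F}\setminus\mathcal{F}'$ contains at least one set of $\mathcal{S}$; (ii) for every $B\in\mathcal{S}$ there is a family $\mathcal{F}_B\subset\mathcal{F}$ such that $\mathcal{F}_B(B)$ is $(\mathcal{A}(B),\tau)$-homogeneous; (iii) $|\mathcal{F}'|\le\tau^{-q-1}|\mathcal{A}|$.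
   Context: A family is $t$-intersecting if any two of its members (not necessarily distinct) share at least $t$ elements. For a family $\mathcal{G}$ and a set $S$, $\mathcal{G}(S)=\{A\setminus S: A\in\mathcal{G},\ S\subset A\}$. A family $\mathcal{G}$ is $r$-spread if $|\mathcal{G}(X)|\le r^{-|X|}|\mathcal{G}|$ for every set $X$. A family $\mathcal{A}\subset2^{[n]}$ is $(r,q)$-spread if $\mathcal{A}(S)$ is $r$-spread for every $S\subset[n]$ with $|S|\le q$. For families $\mathcal{G}\subset\mathcal{B}$ and $\tau>1$, $\mathcal{G}$ is $(\mathcal{B},\tau)$-homogeneous if for every set $S$, $\frac{|\mathcal{G}(S)|}{|\mathcal{G}|}\le\tau^{|S|}\frac{|\mathcal{B}(S)|}{|\mathcal{B}|}$. *)

theory Defs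
  imports Complex_Main
begin

definition t_intersecting :: "nat \<Rightarrow> 'a set set \<Rightarrow> bool" where
  "t_intersecting t \<F> \<longleftrightarrow> (\<forall>A\<in>\<F>. \<forall>B\<in>\<F>. t \<le> card (A \<inter> B))"

definition link :: "'a set set \<Rightarrow> 'a set \<Rightarrow> 'a set set" where
  "link \<G> S = {A - S | A. A \<in> \<G> \<and> S \<subseteq> A}"

definition spread :: "real \<Rightarrow> 'a set set \<Rightarrow> bool" where
  "spread r \<G> \<longleftrightarrow>
    (\<forall>X. real (card (link \<G> X)) \<le> r powi (- int (card X)) * real (card \<G>))"

definition rq_spread :: "nat \<Rightarrow> real \<Rightarrow> nat \<Rightarrow> nat set set \<Rightarrow> bool" where
  "rq_spread n r q \<A> \<longleftrightarrow>
    \<A> \<subseteq> Pow {1..n} \<and> (\<forall>S. S \<subseteq> {1..n} \<and> card S \<le> q \<longrightarrow> spread r (link \<A> S))"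

text \<open>
  Nonemptiness of \<open>\<G>\<close>, implicit in the division by \<open>|\<G>|\<close>, is required explicitly: since
  \<open>x / 0 = 0\<close> in HOL, the empty family would otherwise be homogeneous with respect to
  every \<open>\<B>\<close>.
\<close>

definition homogeneous :: "'a set set \<Rightarrow> real \<Rightarrow> 'a set set \<Rightarrow> bool" where
  "homogeneous \<B> \<tau> \<G> \<longleftrightarrow>
    \<G> \<subseteq> \<B> \<and> \<G> \<noteq> {} \<and>
    (\<forall>S. real (card (link \<G> S)) / real (card \<G>)
          \<le> \<tau> ^ card S * (real (card (link \<B> S)) / real (card \<B>)))"

end

theory Submission
  imports Defs "HOL-Library.Log_Nat"
begin

text \<open>
  Take for \<open>\<S>\<close> all sets \<open>B\<close> of size at most \<open>q\<close> at which some subfamily of \<open>\<F>\<close> has a homogeneous link,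
  and for \<open>\<F>'\<close> the members of \<open>\<F>\<close> containing none of them. A set \<open>S\<close> that is inclusion-maximal with
  \<open>|\<F>'(S)| / |\<F>'| \<ge> \<tau>^|S| |\<A>(S)| / |\<A>|\<close> has a homogeneous link \<open>\<F>'(S)\<close>, so \<open>|S| > q\<close>, and
  \<open>|\<F>'(S)| \<le> |\<A>(S)|\<close> bounds \<open>|\<F>'|\<close>.

  For \<open>B, C \<in> \<S>\<close>, spreadness of \<open>\<A>(B)\<close> and homogeneity make the link at \<open>B\<close> spread, and at least half
  of its members avoid \<open>C\<close>. A uniformly random set contains a member of such a family with
  probability above \<open>1/2\<close>, so a random set and its complement yield disjoint members for \<open>B\<close> and
  \<open>C\<close>. Adding back \<open>B\<close> and \<open>C\<close> gives two members of \<open>\<F>\<close> meeting exactly in \<open>B \<inter> C\<close>.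

  The probability bound is the minimal fragment argument of Park and Pham: the random set is a union of
  about \<open>log\<^sub>2 k\<close> sparse independent sets \<open>W\<close>, and after exposing each of them almost every member of
  the family has a fragment \<open>A - W\<close> (\<open>A\<close> in the family) of less than half the previous size bound.
\<close>

section \<open>Biased random subsets\<close>

text \<open>
  The parameter \<open>s\<close> is the probability of omitting a point, so that uniting independent random
  sets multiplies parameters.
\<close>

definition subset_weight :: "real \<Rightarrow> 'a set \<Rightarrow> 'a set \<Rightarrow> real" where
  "subset_weight s V W = (1 - s) ^ card W * s ^ card (V - W)"

lemma subset_weight_nonneg: "0 \<le> s \<Longrightarrow> s \<le> 1 \<Longrightarrow> 0 \<le> subset_weight s V W"
  by (simp add: subset_weight_def)

lemma subset_weight_half:
  assumes "finite V" "W \<subseteq> V"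
  shows "subset_weight (1 / 2) V W = (1 / 2) ^ card V"
proof -
  have "card W + card (V - W) = card V"
    using assms by (simp add: card_Diff_subset card_mono finite_subset)
  then show ?thesis
    by (simp add: subset_weight_def flip: power_add)
qed

lemma sum_subset_weight: "finite V \<Longrightarrow> (\<Sum>W\<in>Pow V. subset_weight s V W) = 1"
  using prod_add[of V "\<lambda>_. 1 - s" "\<lambda>_. s"] by (simp add: subset_weight_def)

lemma subset_weight_Un:
  assumes "finite V" "W \<subseteq> V" "T \<subseteq> V - W" and s: "s < 1"
  shows "subset_weight s V W = subset_weight s V (W \<union> T) * (s / (1 - s)) ^ card T"
proof -
  have fin: "finite W" "finite T"
    using assms by (blast intro: finite_subset)+
  have "V - W = (V - (W \<union> T)) \<union> T"
    using assms by blast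
  also have "card \<dots> = card (V - (W \<union> T)) + card T"
    using assms fin by (intro card_Un_disjoint) auto
  finally have "card (V - W) = card (V - (W \<union> T)) + card T" .
  moreover have "card (W \<union> T) = card W + card T"
    using assms fin by (intro card_Un_disjoint) auto
  ultimately show ?thesis
    using s by (simp add: subset_weight_def power_add power_divide)
qed

lemma subset_weight_insert:
  assumes "finite V" "x \<notin> V" "W \<subseteq> V"
  shows "subset_weight s (insert x V) W = s * subset_weight s V W"
    and "subset_weight s (insert x V) (insert x W) = (1 - s) * subset_weight s V W"
proof -
  have "finite W" "x \<notin> W"
    using assms by (auto intro: finite_subset)
  moreover have "insert x V - W = insert x (V - W)" "insert x V - insert x W = V - W"
    using assms by auto
  ultimately show "subset_weight s (insert x V) W = s * subset_weight s V W"
    "subset_weight s (insert x V) (insert x W) = (1 - s) * subset_weight s V W"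
    using assms by (simp_all add: subset_weight_def)
qed

lemma sum_Pow_insert:
  fixes h :: "'a set \<Rightarrow> 'b::comm_monoid_add"
  assumes "finite V" "x \<notin> V"
  shows "(\<Sum>W\<in>Pow (insert x V). h W) = (\<Sum>W\<in>Pow V. h W + h (insert x W))"
proof -
  have "inj_on (insert x) (Pow V)"
    using assms by (auto simp: inj_on_def)
  then have "sum h (insert x ` Pow V) = (\<Sum>W\<in>Pow V. h (insert x W))"
    by (simp add: sum.reindex)
  moreover have "sum h (Pow (insert x V)) = sum h (Pow V) + sum h (insert x ` Pow V)"
    unfolding Pow_insert using assms by (intro sum.union_disjoint) auto
  ultimately show ?thesis by (simp add: sum.distrib)
qed

lemma subset_weight_convolution:
  assumes "finite V"
  shows "(\<Sum>W\<in>Pow V. \<Sum>W'\<in>Pow V. subset_weight s V W * subset_weight s' V W' * g (W \<union> W'))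
    = (\<Sum>W\<in>Pow V. subset_weight (s * s') V W * g W)"
  using assms
proof (induction V arbitrary: g)
  case empty
  then show ?case by (simp add: subset_weight_def)
next
  case (insert x V)
  let ?g = "\<lambda>U. s * s' * g U + (1 - s * s') * g (insert x U)"
  have "(\<Sum>W\<in>Pow (insert x V). \<Sum>W'\<in>Pow (insert x V).
        subset_weight s (insert x V) W * subset_weight s' (insert x V) W' * g (W \<union> W'))
    = (\<Sum>W\<in>Pow V. \<Sum>W'\<in>Pow V. subset_weight s V W * subset_weight s' V W' * ?g (W \<union> W'))"
    unfolding sum_Pow_insert[OF insert.hyps] sum.distrib[symmetric]
    by (intro sum.cong refl)
      (use insert.hyps in \<open>auto simp: subset_weight_insert algebra_simps\<close>)
  also have "\<dots> = (\<Sum>W\<in>Pow V. subset_weight (s * s') V W * ?g W)"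
    by (rule insert.IH)
  also have "\<dots> = (\<Sum>W\<in>Pow (insert x V). subset_weight (s * s') (insert x V) W * g W)"
    unfolding sum_Pow_insert[OF insert.hyps]
    by (intro sum.cong refl)
      (use insert.hyps in \<open>auto simp: subset_weight_insert algebra_simps\<close>)
  finally show ?case .
qed

text \<open>
  The map \<open>W \<mapsto> (W \<union> T W, T W)\<close> is injective, and moving the points of \<open>T W\<close> from outside to inside
  the set divides its weight by \<open>(s / (1 - s)) ^ card (T W)\<close>.
\<close>

lemma sum_subset_weight_encode_le:
  assumes fin_V: "finite V" and s: "0 \<le> s" "s < 1"
    and encode: "\<And>W. W \<in> \<W> \<Longrightarrow> W \<subseteq> V \<and> T W \<subseteq> V - W \<and> T W \<in> \<T> (W \<union> T W)"
    and fin_codes: "\<And>Z. Z \<subseteq> V \<Longrightarrow> finite (\<T> Z)"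
  shows "(\<Sum>W\<in>\<W>. subset_weight s V W)
    \<le> (\<Sum>Z\<in>Pow V. subset_weight s V Z * (\<Sum>T\<in>\<T> Z. (s / (1 - s)) ^ card T))"
proof -
  define code where "code W = (W \<union> T W, T W)" for W
  define weight where "weight = (\<lambda>(Z, T :: 'a set). subset_weight s V Z * (s / (1 - s)) ^ card T)"
  have "inj_on code \<W>"
  proof (rule inj_onI)
    fix W W' assume "W \<in> \<W>" "W' \<in> \<W>" "code W = code W'"
    then show "W = W'"
      using encode[of W] encode[of W'] by (auto simp: code_def)
  qed
  moreover have "subset_weight s V W = weight (code W)" if "W \<in> \<W>" for W
    unfolding weight_def code_def prod.case
    by (rule subset_weight_Un) (use fin_V s encode[OF that] in auto)
  ultimately have "(\<Sum>W\<in>\<W>. subset_weight s V W) = sum weight (code ` \<W>)"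
    by (simp add: sum.reindex)
  also have "\<dots> \<le> sum weight (Sigma (Pow V) \<T>)"
  proof (rule sum_mono2)
    show "finite (Sigma (Pow V) \<T>)" using fin_V fin_codes by (intro finite_SigmaI) auto
    show "code ` \<W> \<subseteq> Sigma (Pow V) \<T>"
    proof (rule image_subsetI)
      fix W assume "W \<in> \<W>"
      from encode[OF this] show "code W \<in> Sigma (Pow V) \<T>" by (auto simp: code_def)
    qed
    show "0 \<le> weight z" for z
      using s by (auto simp: weight_def subset_weight_nonneg split: prod.split)
  qed
  also have "\<dots> = (\<Sum>Z\<in>Pow V. \<Sum>T\<in>\<T> Z. weight (Z, T))"
    using fin_V fin_codes by (subst sum.Sigma) (auto simp: case_prod_unfold)
  finally show ?thesis by (simp add: weight_def sum_distrib_left)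
qed

definition miss_prob :: "real \<Rightarrow> 'a set \<Rightarrow> ('i \<Rightarrow> 'a set) \<Rightarrow> 'i set \<Rightarrow> real" where
  "miss_prob s V f I = (\<Sum>W\<in>Pow V. subset_weight s V W * of_bool (\<forall>i\<in>I. \<not> f i \<subseteq> W))"

lemma miss_prob_empty_index: "finite V \<Longrightarrow> miss_prob s V f {} = 1"
  by (simp add: miss_prob_def sum_subset_weight)

lemma miss_prob_eq_0: "i \<in> I \<Longrightarrow> f i = {} \<Longrightarrow> miss_prob s V f I = 0"
  unfolding miss_prob_def by (intro sum.neutral) auto

lemma miss_prob_half:
  assumes "finite V"
  shows "miss_prob (1 / 2) V f I = real (card {W\<in>Pow V. \<forall>i\<in>I. \<not> f i \<subseteq> W}) / 2 ^ card V"
proof -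
  have "miss_prob (1 / 2) V f I = (\<Sum>W\<in>Pow V. (1 / 2) ^ card V * of_bool (\<forall>i\<in>I. \<not> f i \<subseteq> W))"
    unfolding miss_prob_def using assms by (intro sum.cong) (simp_all add: subset_weight_half)
  also have "\<dots> = (1 / 2) ^ card V * real (card {W\<in>Pow V. \<forall>i\<in>I. \<not> f i \<subseteq> W})"
    using assms by (simp add: Int_def flip: sum_distrib_left)
  finally show ?thesis by (simp add: power_divide)
qed

lemma miss_prob_mult_le:
  assumes fin_V: "finite V" and probs: "0 \<le> s" "s \<le> 1" "0 \<le> s'" "s' \<le> 1"
    and cover: "\<And>W i. i \<in> J W \<Longrightarrow> \<exists>j\<in>I. f j \<subseteq> W \<union> g W i"
  shows "miss_prob (s * s') V f I \<le> (\<Sum>W\<in>Pow V. subset_weight s V W * miss_prob s' V (g W) (J W))"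
proof -
  have miss: "of_bool (\<forall>i\<in>I. \<not> f i \<subseteq> W \<union> W') \<le> (of_bool (\<forall>i\<in>J W. \<not> g W i \<subseteq> W') :: real)" for W W'
  proof -
    have "\<forall>i\<in>J W. \<not> g W i \<subseteq> W'" if "\<forall>i\<in>I. \<not> f i \<subseteq> W \<union> W'"
      using that cover[of _ W] by blast
    then show ?thesis by (simp add: of_bool_def)
  qed
  have "miss_prob (s * s') V f I = (\<Sum>W\<in>Pow V. subset_weight s V W *
      (\<Sum>W'\<in>Pow V. subset_weight s' V W' * of_bool (\<forall>i\<in>I. \<not> f i \<subseteq> W \<union> W')))"
    unfolding miss_prob_def subset_weight_convolution[OF fin_V, symmetric]
    by (simp add: sum_distrib_left mult.assoc)
  also have "\<dots> \<le> (\<Sum>W\<in>Pow V. subset_weight s V W * miss_prob s' V (g W) (J W))"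
    unfolding miss_prob_def
    using probs miss by (intro sum_mono mult_left_mono subset_weight_nonneg)
  finally show ?thesis .
qed

section \<open>Minimal fragments\<close>

text \<open>
  Families are indexed because distinct members may have equal fragments, and the bound \<open>N\<close> is a
  parameter because it must survive the removal of members with large fragments.
\<close>

definition indexed_spread :: "real \<Rightarrow> real \<Rightarrow> ('i \<Rightarrow> 'a set) \<Rightarrow> 'i set \<Rightarrow> bool" where
  "indexed_spread R N f I \<longleftrightarrow> (\<forall>X. real (card {i\<in>I. X \<subseteq> f i}) * R ^ card X \<le> N)"

lemma indexed_spread_card_le:
  assumes "indexed_spread R N f I"
  shows "real (card I) \<le> N"
  using assms[unfolded indexed_spread_def, rule_format, of "{}"] by simp

lemma indexed_spread_mono:
  assumes spread: "indexed_spread R N f I" and "finite I" and R_nonneg: "0 \<le> R"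
    and "J \<subseteq> I" "\<And>i. i \<in> J \<Longrightarrow> g i \<subseteq> f i"
  shows "indexed_spread R N g J"
  unfolding indexed_spread_def
proof
  fix X
  have "card {i\<in>J. X \<subseteq> g i} \<le> card {i\<in>I. X \<subseteq> f i}"
    using assms by (intro card_mono) auto
  then have "real (card {i\<in>J. X \<subseteq> g i}) * R ^ card X \<le> real (card {i\<in>I. X \<subseteq> f i}) * R ^ card X"
    using R_nonneg by (intro mult_right_mono) auto
  also have "\<dots> \<le> N"
    using spread by (simp add: indexed_spread_def)
  finally show "real (card {i\<in>J. X \<subseteq> g i}) * R ^ card X \<le> N" .
qed

definition fragments :: "('i \<Rightarrow> 'a set) \<Rightarrow> 'i set \<Rightarrow> 'a set \<Rightarrow> 'i \<Rightarrow> 'a set set" where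
  "fragments f I W i = {T \<in> (\<lambda>j. f j - W) ` I. T \<subseteq> f i}"

definition min_fragment :: "('i \<Rightarrow> 'a set) \<Rightarrow> 'i set \<Rightarrow> 'a set \<Rightarrow> 'i \<Rightarrow> 'a set" where
  "min_fragment f I W i =
    (SOME T. T \<in> fragments f I W i \<and> (\<forall>T'\<in>fragments f I W i. T' \<subseteq> T \<longrightarrow> T = T'))"

lemma min_fragment_minimal:
  assumes "finite I" "i \<in> I"
  shows "min_fragment f I W i \<in> fragments f I W i"
    and "T \<in> fragments f I W i \<Longrightarrow> T \<subseteq> min_fragment f I W i \<Longrightarrow> min_fragment f I W i = T"
proof -
  have "finite (fragments f I W i)" "fragments f I W i \<noteq> {}"
    using assms by (auto simp: fragments_def)
  from finite_has_minimal[OF this] have "\<exists>T. T \<in> fragments f I W i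
      \<and> (\<forall>T'\<in>fragments f I W i. T' \<subseteq> T \<longrightarrow> T = T')" by blast
  note someI_ex[OF this, folded min_fragment_def]
  then show "min_fragment f I W i \<in> fragments f I W i"
    and "T \<in> fragments f I W i \<Longrightarrow> T \<subseteq> min_fragment f I W i \<Longrightarrow> min_fragment f I W i = T"
    by blast+
qed

lemma min_fragment_subset: "finite I \<Longrightarrow> i \<in> I \<Longrightarrow> min_fragment f I W i \<subseteq> f i"
  using min_fragment_minimal(1)[of I i f W] by (simp add: fragments_def)

lemma min_fragment_eq_diff: "finite I \<Longrightarrow> i \<in> I \<Longrightarrow> \<exists>j\<in>I. min_fragment f I W i = f j - W"
  using min_fragment_minimal(1)[of I i f W] by (auto simp: fragments_def)

definition common_subsets :: "('i \<Rightarrow> 'a set) \<Rightarrow> 'i set \<Rightarrow> 'a set \<Rightarrow> 'a set set" where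
  "common_subsets f I Z = {T. (\<exists>i\<in>I. f i \<subseteq> Z) \<and> (\<forall>i\<in>I. f i \<subseteq> Z \<longrightarrow> T \<subseteq> f i)}"

lemma min_fragment_in_common_subsets:
  assumes "finite I" "i \<in> I"
  shows "min_fragment f I W i \<in> common_subsets f I (W \<union> min_fragment f I W i)"
proof -
  let ?T = "min_fragment f I W i"
  have "?T \<subseteq> f j" if j: "j \<in> I" "f j \<subseteq> W \<union> ?T" for j
  proof -
    have "f j - W \<subseteq> ?T"
      using j by blast
    moreover from this have "f j - W \<in> fragments f I W i"
      using j min_fragment_subset[OF assms, of f W] by (auto simp: fragments_def)
    ultimately have "?T = f j - W"
      using min_fragment_minimal(2)[OF assms] by metis
    then show ?thesis by blast
  qed
  moreover have "\<exists>j\<in>I. f j \<subseteq> W \<union> ?T"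
    using min_fragment_eq_diff[OF assms, of f W] by blast
  ultimately show ?thesis
    by (simp add: common_subsets_def)
qed

lemma card_common_subsets_le:
  assumes fin: "\<And>i. i \<in> I \<Longrightarrow> finite (f i)" and card_le: "\<And>i. i \<in> I \<Longrightarrow> card (f i) \<le> b"
  shows "finite (common_subsets f I Z)" and "card (common_subsets f I Z) \<le> 2 ^ b"
proof -
  have "finite (common_subsets f I Z) \<and> card (common_subsets f I Z) \<le> 2 ^ b"
  proof (cases "\<exists>i\<in>I. f i \<subseteq> Z")
    case True
    then obtain i where i: "i \<in> I" "common_subsets f I Z \<subseteq> Pow (f i)"
      by (auto simp: common_subsets_def)
    then have "card (common_subsets f I Z) \<le> 2 ^ card (f i)"
      using fin card_mono[of "Pow (f i)"] by (simp add: card_Pow)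
    also have "\<dots> \<le> 2 ^ b"
      using card_le i by simp
    finally show ?thesis
      using fin i finite_subset by fastforce
  next
    case False
    then show ?thesis by (simp add: common_subsets_def)
  qed
  then show "finite (common_subsets f I Z)" "card (common_subsets f I Z) \<le> 2 ^ b" by auto
qed

lemma sum_indexed_spread_le:
  assumes spread: "indexed_spread R N f I"
    and R_nonneg: "0 \<le> R" and c_bounds: "0 \<le> c" "c \<le> e * R" and e_bounds: "0 \<le> e" "e \<le> 1"
    and card_ge: "\<And>T. T \<in> \<T> \<Longrightarrow> d \<le> card T"
  shows "(\<Sum>T\<in>\<T>. c ^ card T * real (card {i\<in>I. T \<subseteq> f i})) \<le> real (card \<T>) * (N * e ^ d)"
proof (rule sum_bounded_above)
  fix T assume T: "T \<in> \<T>"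
  have "c ^ card T * real (card {i\<in>I. T \<subseteq> f i})
      \<le> (e * R) ^ card T * real (card {i\<in>I. T \<subseteq> f i})"
    using c_bounds by (intro mult_right_mono power_mono) auto
  also have "\<dots> = e ^ card T * (real (card {i\<in>I. T \<subseteq> f i}) * R ^ card T)"
    by (simp add: power_mult_distrib)
  also have "\<dots> \<le> e ^ d * N"
    using spread R_nonneg e_bounds card_ge[OF T]
    by (intro mult_mono power_decreasing) (auto simp: indexed_spread_def)
  finally show "c ^ card T * real (card {i\<in>I. T \<subseteq> f i}) \<le> N * e ^ d"
    by (simp add: mult.commute)
qed

text \<open>
  For fixed \<open>i\<close>, a set \<open>W\<close> is encoded by \<open>(W \<union> T, T)\<close>, where \<open>T\<close> is the fragment of \<open>i\<close>, and \<open>T\<close> is a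
  common subset of all members of the family inside \<open>W \<union> T\<close>.
\<close>

lemma sum_large_fragments_le_sum_common_subsets:
  assumes fin: "finite V" "finite I" and subset: "\<And>i. i \<in> I \<Longrightarrow> f i \<subseteq> V" and s_bounds: "0 \<le> s" "s < 1"
  shows "(\<Sum>W\<in>Pow V. subset_weight s V W * real (card {i\<in>I. d \<le> card (min_fragment f I W i)}))
    \<le> (\<Sum>Z\<in>Pow V. subset_weight s V Z * (\<Sum>T\<in>{T \<in> common_subsets f I Z. d \<le> card T}.
        (s / (1 - s)) ^ card T * real (card {i\<in>I. T \<subseteq> f i})))"
proof -
  let ?T = "min_fragment f I" and ?c = "s / (1 - s)"
  define \<T> where "\<T> Z = {T \<in> common_subsets f I Z. d \<le> card T}" for Z
  have "\<T> Z \<subseteq> Pow V" for Z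
    using subset unfolding \<T>_def common_subsets_def by blast
  then have finite_\<T>: "finite (\<T> Z)" for Z
    by (rule finite_subset) (simp add: fin(1))
  have "(\<Sum>W\<in>Pow V. subset_weight s V W * real (card {i\<in>I. d \<le> card (?T W i)}))
      = (\<Sum>W\<in>Pow V. \<Sum>i\<in>{i\<in>I. d \<le> card (?T W i)}. subset_weight s V W)"
    by (simp add: mult.commute)
  also have "\<dots> = (\<Sum>i\<in>I. \<Sum>W\<in>{W\<in>Pow V. d \<le> card (?T W i)}. subset_weight s V W)"
    using fin by (intro sum.swap_restrict) auto
  also have "\<dots> \<le> (\<Sum>i\<in>I. \<Sum>Z\<in>Pow V. subset_weight s V Z * (\<Sum>T\<in>{T\<in>\<T> Z. T \<subseteq> f i}. ?c ^ card T))"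
  proof (intro sum_mono sum_subset_weight_encode_le)
    fix i W assume i: "i \<in> I" and W: "W \<in> {W\<in>Pow V. d \<le> card (?T W i)}"
    have "?T W i \<subseteq> V - W"
      using min_fragment_subset[OF fin(2) i, of f W] min_fragment_eq_diff[OF fin(2) i, of f W] subset[OF i]
      by blast
    then show "W \<subseteq> V \<and> ?T W i \<subseteq> V - W \<and> ?T W i \<in> {T \<in> \<T> (W \<union> ?T W i). T \<subseteq> f i}"
      using W min_fragment_subset[OF fin(2) i, of f W]
        min_fragment_in_common_subsets[OF fin(2) i, of f W]
      by (simp add: \<T>_def)
  qed (use fin s_bounds finite_\<T> in auto)
  also have "\<dots> = (\<Sum>Z\<in>Pow V. subset_weight s V Z * (\<Sum>i\<in>I. \<Sum>T\<in>{T\<in>\<T> Z. T \<subseteq> f i}. ?c ^ card T))"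
    unfolding sum_distrib_left[of _ _ I] by (rule sum.swap)
  also have "\<dots> = (\<Sum>Z\<in>Pow V. subset_weight s V Z *
      (\<Sum>T\<in>\<T> Z. ?c ^ card T * real (card {i\<in>I. T \<subseteq> f i})))"
    using fin finite_\<T> by (simp add: sum.swap_restrict[of I] mult.commute)
  finally show ?thesis by (simp only: \<T>_def)
qed

lemma sum_large_fragments_le:
  assumes fin: "finite V" "finite I"
    and members: "\<And>i. i \<in> I \<Longrightarrow> f i \<subseteq> V" "\<And>i. i \<in> I \<Longrightarrow> card (f i) \<le> b"
    and s_bounds: "0 \<le> s" "s < 1" "s / (1 - s) \<le> e * R" and R_nonneg: "0 \<le> R" and e_bounds: "0 \<le> e" "e \<le> 1"
    and spread: "indexed_spread R N f I"
  shows "(\<Sum>W\<in>Pow V. subset_weight s V W * real (card {i\<in>I. d \<le> card (min_fragment f I W i)}))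
    \<le> N * (2 ^ b * e ^ d)"
proof -
  let ?\<T> = "\<lambda>Z. {T \<in> common_subsets f I Z. d \<le> card T}" and ?c = "s / (1 - s)"
  have N_nonneg: "0 \<le> N" using indexed_spread_card_le[OF spread] by linarith
  have common_sum_le: "(\<Sum>T\<in>?\<T> Z. ?c ^ card T * real (card {i\<in>I. T \<subseteq> f i})) \<le> N * (2 ^ b * e ^ d)" for Z
  proof -
    have "finite (f i)" if "i \<in> I" for i
      using members(1)[OF that] fin(1) by (rule finite_subset)
    note common = card_common_subsets_le[of I f b, OF this members(2)]
    have "card (?\<T> Z) \<le> card (common_subsets f I Z)"
      using common(1) by (intro card_mono) auto
    then have "card (?\<T> Z) \<le> 2 ^ b"
      using common(2) by (rule order_trans)
    then have "real (card (?\<T> Z)) \<le> 2 ^ b"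
      by (metis of_nat_le_iff of_nat_numeral of_nat_power)
    then have "real (card (?\<T> Z)) * (N * e ^ d) \<le> 2 ^ b * (N * e ^ d)"
      using N_nonneg e_bounds(1) by (intro mult_right_mono) auto
    moreover have "(\<Sum>T\<in>?\<T> Z. ?c ^ card T * real (card {i\<in>I. T \<subseteq> f i}))
        \<le> real (card (?\<T> Z)) * (N * e ^ d)"
      using spread R_nonneg _ s_bounds(3) e_bounds by (rule sum_indexed_spread_le) (use s_bounds in auto)
    ultimately show ?thesis by (simp add: mult_ac)
  qed
  have "(\<Sum>W\<in>Pow V. subset_weight s V W * real (card {i\<in>I. d \<le> card (min_fragment f I W i)}))
      \<le> (\<Sum>Z\<in>Pow V. subset_weight s V Z * (\<Sum>T\<in>?\<T> Z. ?c ^ card T * real (card {i\<in>I. T \<subseteq> f i})))"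
    using fin members(1) s_bounds(1,2) by (rule sum_large_fragments_le_sum_common_subsets)
  also have "\<dots> \<le> (\<Sum>Z\<in>Pow V. subset_weight s V Z * (N * (2 ^ b * e ^ d)))"
    using common_sum_le s_bounds by (intro sum_mono mult_left_mono subset_weight_nonneg) auto
  also have "\<dots> = N * (2 ^ b * e ^ d)"
    using sum_subset_weight[OF fin(1), of s] by (simp flip: sum_distrib_right)
  finally show ?thesis .
qed

lemma fragment_error_le: "(2::real) ^ 2 ^ Suc j * (1 / 64) ^ 2 ^ j \<le> (1 / 2) ^ (j + 2)"
proof -
  have "(2::real) ^ 2 ^ Suc j * (1 / 64) ^ 2 ^ j = (2 ^ 2 * (1 / 64)) ^ 2 ^ j"
    unfolding power_mult_distrib by (simp add: power_mult)
  also have "\<dots> = (1 / 2) ^ (4 * 2 ^ j)"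
    unfolding power_mult by (simp add: power_divide)
  also have "\<dots> \<le> (1 / 2) ^ (j + 2)"
    using less_exp[of j] by (intro power_decreasing) linarith+
  finally show ?thesis .
qed

text \<open>
  Exposing one random set replaces every member by its minimal fragment. Members with a large
  fragment are dropped and paid for by the deficit \<open>N - card I\<close>.
\<close>

lemma miss_prob_fragments_le:
  fixes f :: "'i \<Rightarrow> 'a set"
  assumes fin: "finite V" "finite I" and probs: "0 \<le> s" "s \<le> 1" "0 \<le> s'" "s' \<le> 1" and N_nonneg: "0 \<le> N"
    and small: "\<And>W. N * miss_prob s' V (min_fragment f I W) {i\<in>I. card (min_fragment f I W i) < d}
      \<le> N - real (card {i\<in>I. card (min_fragment f I W i) < d}) + \<delta>"
  shows "N * miss_prob (s * s') V f I \<le> N - real (card I) + \<delta>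
    + (\<Sum>W\<in>Pow V. subset_weight s V W * real (card {i\<in>I. d \<le> card (min_fragment f I W i)}))"
proof -
  let ?T = "min_fragment f I"
  let ?small = "\<lambda>W. {i\<in>I. card (?T W i) < d}" and ?large = "\<lambda>W. {i\<in>I. d \<le> card (?T W i)}"
  have card_I: "card I = card (?small W) + card (?large W)" for W
  proof -
    have "I = ?small W \<union> ?large W" by auto
    also have "card \<dots> = card (?small W) + card (?large W)"
      using fin(2) by (intro card_Un_disjoint) auto
    finally show ?thesis .
  qed
  have cover: "\<exists>j\<in>I. f j \<subseteq> W \<union> ?T W i" if "i \<in> I" for W i
    using min_fragment_eq_diff[OF fin(2) that, of f W] by blast
  have "miss_prob (s * s') V f I
      \<le> (\<Sum>W\<in>Pow V. subset_weight s V W * miss_prob s' V (?T W) (?small W))"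
    using fin(1) probs cover by (intro miss_prob_mult_le) auto
  from mult_left_mono[OF this N_nonneg]
  have "N * miss_prob (s * s') V f I
      \<le> (\<Sum>W\<in>Pow V. subset_weight s V W * (N * miss_prob s' V (?T W) (?small W)))"
    by (simp add: sum_distrib_left mult.left_commute)
  also have "\<dots> \<le> (\<Sum>W\<in>Pow V. subset_weight s V W * (N - real (card I) + \<delta> + real (card (?large W))))"
  proof (intro sum_mono mult_left_mono subset_weight_nonneg probs)
    show "N * miss_prob s' V (?T W) (?small W) \<le> N - real (card I) + \<delta> + real (card (?large W))" for W
      using small[of W] card_I[of W] by linarith
  qed
  also have "\<dots> = N - real (card I) + \<delta>
      + (\<Sum>W\<in>Pow V. subset_weight s V W * real (card (?large W)))"
    unfolding distrib_left[of "subset_weight s V _" "_ + \<delta>"] sum.distrib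
      sum_distrib_right[symmetric] sum_subset_weight[OF fin(1)] by simp
  finally show ?thesis .
qed

lemma indexed_spread_miss_prob_empty_members_le:
  assumes fin_V: "finite V" and spread: "indexed_spread R N f I" and empty: "\<And>i. i \<in> I \<Longrightarrow> f i = {}"
  shows "N * miss_prob s V f I \<le> N - real (card I)"
proof (cases "I = {}")
  case True
  then show ?thesis by (simp add: miss_prob_empty_index[OF fin_V])
next
  case False
  then obtain i where "i \<in> I" by blast
  then have "miss_prob s V f I = 0"
    using empty by (intro miss_prob_eq_0) auto
  then show ?thesis using indexed_spread_card_le[OF spread] by simp
qed

lemma indexed_spread_miss_prob_le:
  fixes f :: "'i \<Rightarrow> 'a set"
  assumes fin_V: "finite V" and s_bounds: "0 < s" "s < 1" and R: "0 < R" "64 * s \<le> R * (1 - s)"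
    and "finite I" "\<And>i. i \<in> I \<Longrightarrow> f i \<subseteq> V" "\<And>i. i \<in> I \<Longrightarrow> card (f i) < 2 ^ j"
    and "indexed_spread R N f I"
  shows "N * miss_prob (s ^ j) V f I \<le> N - real (card I) + N * ((1 - (1 / 2) ^ j) / 2)"
  using assms(6-9)
proof (induction j arbitrary: I f)
  case 0
  have "f i = {}" if "i \<in> I" for i
    using 0(2,3)[OF that] fin_V finite_subset by fastforce
  from indexed_spread_miss_prob_empty_members_le[OF fin_V 0(4) this]
  show ?case by simp
next
  case (Suc j)
  note fin = fin_V Suc.prems(1)
  have N_nonneg: "0 \<le> N" using indexed_spread_card_le[OF Suc.prems(4)] by linarith
  let ?T = "min_fragment f I"
  let ?\<delta> = "N * ((1 - (1 / 2) ^ j) / 2)"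
  have "N * miss_prob (s ^ j) V (?T W) {i\<in>I. card (?T W i) < 2 ^ j}
      \<le> N - real (card {i\<in>I. card (?T W i) < 2 ^ j}) + ?\<delta>" for W
  proof (rule Suc.IH)
    have fragment_subset: "?T W i \<subseteq> f i" if "i \<in> I" for i
      using min_fragment_subset[OF fin(2) that] .
    then show "?T W i \<subseteq> V" if "i \<in> {i\<in>I. card (?T W i) < 2 ^ j}" for i
      using that Suc.prems(2) by blast
    show "indexed_spread R N (?T W) {i\<in>I. card (?T W i) < 2 ^ j}"
      by (rule indexed_spread_mono[OF Suc.prems(4) fin(2)]) (use R(1) fragment_subset in auto)
  qed (use fin in auto)
  then have "N * miss_prob (s ^ Suc j) V f I \<le> N - real (card I) + ?\<delta>
      + (\<Sum>W\<in>Pow V. subset_weight s V W * real (card {i\<in>I. 2 ^ j \<le> card (?T W i)}))"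
    unfolding power_Suc using fin s_bounds N_nonneg
    by (intro miss_prob_fragments_le) (auto simp: power_le_one)
  also have "\<dots> \<le> N - real (card I) + ?\<delta> + N * (2 ^ 2 ^ Suc j * (1 / 64) ^ 2 ^ j)"
    using fin Suc.prems s_bounds R
    by (intro add_left_mono sum_large_fragments_le) (auto intro: less_imp_le simp: field_simps)
  also have "\<dots> \<le> N - real (card I) + ?\<delta> + N * (1 / 2) ^ (j + 2)"
    using N_nonneg fragment_error_le by (intro add_left_mono mult_left_mono)
  also have "\<dots> = N - real (card I) + N * ((1 - (1 / 2) ^ Suc j) / 2)"
    by (simp add: field_simps)
  finally show ?case .
qed

section \<open>Links and spread families\<close>

lemma link_eq_image: "link \<G> S = (\<lambda>A. A - S) ` {A\<in>\<G>. S \<subseteq> A}"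
  by (auto simp: link_def)

lemma link_empty_set [simp]: "link \<G> {} = \<G>"
  by (auto simp: link_def)

lemma link_mono: "\<G> \<subseteq> \<H> \<Longrightarrow> link \<G> S \<subseteq> link \<H> S"
  by (auto simp: link_def)

lemma link_eq_empty_iff: "link \<G> S = {} \<longleftrightarrow> (\<forall>A\<in>\<G>. \<not> S \<subseteq> A)"
  by (auto simp: link_def)

lemma card_link: "card (link \<G> S) = card {A\<in>\<G>. S \<subseteq> A}"
  unfolding link_eq_image by (intro card_image) (auto simp: inj_on_def)

lemma finite_link: "finite \<G> \<Longrightarrow> finite (link \<G> S)"
  by (simp add: link_eq_image)

lemma link_link:
  assumes "S \<inter> X = {}"
  shows "link (link \<G> S) X = link \<G> (S \<union> X)"
proof -
  have "{B \<in> (\<lambda>A. A - S) ` {A\<in>\<G>. S \<subseteq> A}. X \<subseteq> B} = (\<lambda>A. A - S) ` {A\<in>\<G>. S \<union> X \<subseteq> A}"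
    using assms by auto
  then show ?thesis
    by (simp add: link_eq_image image_image Diff_Un Diff_eq Int_assoc)
qed

lemma link_link_eq_empty: "S \<inter> X \<noteq> {} \<Longrightarrow> link (link \<G> S) X = {}"
  by (auto simp: link_def)

lemma spread_iff_indexed_spread:
  assumes "0 < r"
  shows "spread r \<G> \<longleftrightarrow> indexed_spread r (real (card \<G>)) (\<lambda>A. A) \<G>"
proof -
  have "real (card (link \<G> X)) \<le> r powi (- int (card X)) * real (card \<G>)
      \<longleftrightarrow> real (card {A\<in>\<G>. X \<subseteq> A}) * r ^ card X \<le> real (card \<G>)" for X
    using assms pos_le_divide_eq[of "r ^ card X"] by (simp add: card_link power_int_minus divide_inverse mult.commute)
  then show ?thesis by (simp only: spread_def indexed_spread_def)
qed

lemma spread_subfamily: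
  assumes spread: "spread r \<L>" and r_pos: "0 < r" and sub: "finite \<L>" "\<G> \<subseteq> \<L>"
    and ratio: "1 \<le> c" "real (card \<L>) \<le> c * real (card \<G>)"
  shows "spread (r / c) \<G>"
proof -
  have "real (card {A\<in>\<G>. X \<subseteq> A}) * (r / c) ^ card X \<le> real (card \<G>)" for X
  proof (cases "card X = 0")
    case True
    have "card {A\<in>\<G>. X \<subseteq> A} \<le> card \<G>"
      using assms by (intro card_mono) (auto intro: finite_subset)
    then show ?thesis using True by simp
  next
    case False
    have "indexed_spread r (real (card \<L>)) (\<lambda>A. A) \<G>"
      using spread r_pos sub unfolding spread_iff_indexed_spread[OF r_pos]
      by (elim indexed_spread_mono) simp_all
    then have "real (card {A\<in>\<G>. X \<subseteq> A}) * r ^ card X \<le> real (card \<L>)"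
      by (simp add: indexed_spread_def)
    also have "\<dots> \<le> c * real (card \<G>)" by (rule ratio(2))
    also have "\<dots> \<le> c ^ card X * real (card \<G>)"
      using False ratio(1) by (intro mult_right_mono self_le_power) auto
    finally show ?thesis
      using ratio(1) by (simp add: power_divide field_simps)
  qed
  then show ?thesis
    using assms by (simp add: spread_iff_indexed_spread indexed_spread_def)
qed

lemma spread_card_avoiding_ge:
  assumes spread: "spread r \<L>" and fin: "finite \<L>" "finite D" and r: "0 < r" "2 * real (card D) \<le> r"
  shows "real (card \<L>) \<le> 2 * real (card {A\<in>\<L>. A \<inter> D = {}})"
proof -
  let ?\<G> = "{A\<in>\<L>. A \<inter> D = {}}"
  have "card (\<L> - ?\<G>) \<le> card (\<Union>x\<in>D. {A\<in>\<L>. {x} \<subseteq> A})"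
    using assms by (intro card_mono) auto
  also have "\<dots> \<le> (\<Sum>x\<in>D. card {A\<in>\<L>. {x} \<subseteq> A})"
    using fin(2) by (rule card_UN_le)
  finally have "real (card (\<L> - ?\<G>)) \<le> (\<Sum>x\<in>D. real (card {A\<in>\<L>. {x} \<subseteq> A}))"
    by (simp only: of_nat_sum[symmetric] of_nat_le_iff)
  also have "\<dots> \<le> real (card D) * (real (card \<L>) / r)"
  proof (rule sum_bounded_above)
    fix x
    have "real (card {A\<in>\<L>. {x} \<subseteq> A}) * r ^ card {x} \<le> real (card \<L>)"
      using spread unfolding spread_iff_indexed_spread[OF r(1)] indexed_spread_def by blast
    then show "real (card {A\<in>\<L>. {x} \<subseteq> A}) \<le> real (card \<L>) / r"
      using r(1) by (simp add: field_simps)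
  qed
  also have "\<dots> \<le> real (card \<L>) / 2"
    using mult_right_mono[OF r(2), of "real (card \<L>)"] r(1) by (simp add: field_simps)
  finally have "real (card (\<L> - ?\<G>)) \<le> real (card \<L>) / 2" .
  moreover have "card (\<L> - ?\<G>) = card \<L> - card ?\<G>" "card ?\<G> \<le> card \<L>"
    using fin(1) by (auto intro: card_Diff_subset card_mono)
  ultimately show ?thesis by simp
qed

section \<open>Disjoint members of spread families\<close>

lemma root_one_minus_le:
  assumes m_pos: "0 < m" and "x \<le> 1"
  shows "root m (1 - x) \<le> 1 - x / real m"
proof -
  have quotient_le: "x / real m \<le> 1" using assms by (simp add: field_simps)
  then have "1 - x \<le> (1 - x / real m) ^ m"
    using Bernoulli_inequality[of "- (x / real m)" m] m_pos by simp
  then have "root m (1 - x) \<le> root m ((1 - x / real m) ^ m)"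
    using m_pos by (rule real_root_le_mono[rotated])
  also have "\<dots> = 1 - x / real m"
    using m_pos quotient_le by (simp add: real_root_power_cancel)
  finally show ?thesis .
qed

lemma spread_miss_prob_half_less:
  assumes fin_V: "finite V" and \<G>: "\<G> \<subseteq> Pow V" "\<G> \<noteq> {}"
    and k: "1 \<le> k" "\<And>A. A \<in> \<G> \<Longrightarrow> card A \<le> k"
    and R_ge: "2 ^ 7 * log 2 (2 * real k) \<le> R" and spread: "spread R \<G>"
  shows "miss_prob (1 / 2) V (\<lambda>A. A) \<G> < 1 / 2"
proof -
  define m where "m = floorlog 2 k"
  define s where "s = root m (1 / 2)"
  have m: "0 < m" "real m \<le> log 2 (2 * real k)"
    using k by (simp_all add: m_def floorlog_def log_mult)
  have k_less: "k < 2 ^ m"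
    using floorlog_bounds[of k 2] k by (simp add: m_def)
  have s: "s ^ m = 1 / 2" "0 < s" "s \<le> 1 - 1 / 2 / real m"
    using root_one_minus_le[of m "1 / 2"] m(1) by (simp_all add: s_def)
  moreover have "0 < 1 / 2 / real m" using m(1) by simp
  ultimately have s_less_1: "s < 1" by linarith
  have R_ge_m: "2 ^ 7 * real m \<le> R" using R_ge m(2) by simp
  have "0 < 2 ^ 7 * real m" using m(1) by simp
  then have R_pos: "0 < R" using R_ge_m by (rule less_le_trans)
  have "64 * s \<le> (2 ^ 7 * real m) * (1 / 2 / real m)" using s_less_1 m(1) by simp
  also have "\<dots> \<le> R * (1 - s)"
  proof (rule mult_mono)
    show "1 / 2 / real m \<le> 1 - s" using s(3) by linarith
  qed (use R_ge_m R_pos in simp_all)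
  finally have s_le: "64 * s \<le> R * (1 - s)" .
  have fin: "finite \<G>"
    using \<G>(1) fin_V by (auto intro: finite_subset)
  have "real (card \<G>) * miss_prob (s ^ m) V (\<lambda>A. A) \<G>
      \<le> real (card \<G>) - real (card \<G>) + real (card \<G>) * ((1 - (1 / 2) ^ m) / 2)"
    using spread \<G>(1) unfolding spread_iff_indexed_spread[OF R_pos]
    by (intro indexed_spread_miss_prob_le[OF fin_V s(2) s_less_1 R_pos s_le fin])
      (auto intro: le_less_trans[OF k(2) k_less])
  then have "miss_prob (1 / 2) V (\<lambda>A. A) \<G> \<le> (1 - (1 / 2) ^ m) / 2"
    using fin \<G>(2) by (simp add: s(1) card_gt_0_iff)
  also have "\<dots> < 1 / 2" by simp
  finally show ?thesis .
qed

lemma spread_families_disjoint_members: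
  assumes fin_V: "finite V" and k: "1 \<le> k" "2 ^ 7 * log 2 (2 * real k) \<le> R"
    and \<G>: "\<G> \<subseteq> Pow V" "\<G> \<noteq> {}" "\<And>A. A \<in> \<G> \<Longrightarrow> card A \<le> k" "spread R \<G>"
    and \<H>: "\<H> \<subseteq> Pow V" "\<H> \<noteq> {}" "\<And>A. A \<in> \<H> \<Longrightarrow> card A \<le> k" "spread R \<H>"
  shows "\<exists>A\<in>\<G>. \<exists>B\<in>\<H>. A \<inter> B = {}"
proof -
  define miss where "miss \<K> = {W\<in>Pow V. \<forall>A\<in>\<K>. \<not> A \<subseteq> W}" for \<K> :: "'a set set"
  have "2 * card (miss \<K>) < 2 ^ card V" if "miss_prob (1 / 2) V (\<lambda>A. A) \<K> < 1 / 2" for \<K>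
  proof -
    have "real (2 * card (miss \<K>)) < real (2 ^ card V)"
      using that unfolding miss_prob_half[OF fin_V] miss_def by (simp add: field_simps)
    then show ?thesis by (simp only: of_nat_less_iff)
  qed
  then have few: "2 * card (miss \<G>) < 2 ^ card V" "2 * card (miss \<H>) < 2 ^ card V"
    using spread_miss_prob_half_less[OF fin_V \<G>(1,2) k(1) \<G>(3) k(2) \<G>(4)]
      spread_miss_prob_half_less[OF fin_V \<H>(1,2) k(1) \<H>(3) k(2) \<H>(4)] by blast+
  have fin: "finite (miss \<K>)" for \<K>
    using fin_V by (simp add: miss_def)
  have "card (miss \<G> \<union> (-) V ` miss \<H>) \<le> card (miss \<G>) + card ((-) V ` miss \<H>)"
    by (rule card_Un_le)
  also have "\<dots> \<le> card (miss \<G>) + card (miss \<H>)"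
    using fin by (intro add_left_mono card_image_le)
  also have "\<dots> < card (Pow V)"
    using few fin_V by (simp add: card_Pow)
  finally have "\<not> Pow V \<subseteq> miss \<G> \<union> (-) V ` miss \<H>"
    using fin by (meson card_mono finite_UnI finite_imageI not_le)
  then obtain W where W: "W \<subseteq> V" "W \<notin> miss \<G>" "W \<notin> (-) V ` miss \<H>" by blast
  have "V - (V - W) = W" using W(1) by blast
  then have "V - W \<notin> miss \<H>" using W(3) by (metis image_eqI)
  then obtain A B where "A \<in> \<G>" "A \<subseteq> W" "B \<in> \<H>" "B \<subseteq> V - W"
    using W(1,2) by (auto simp: miss_def)
  then show ?thesis by blast
qed

section \<open>Homogeneous links\<close>

definition link_density :: "'a set set \<Rightarrow> 'a set \<Rightarrow> real" where
  "link_density \<G> S = real (card (link \<G> S)) / real (card \<G>)"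

lemma link_density_nonneg: "0 \<le> link_density \<G> S"
  by (simp add: link_density_def)

lemma link_density_pos:
  assumes "finite \<G>" "link \<G> S \<noteq> {}"
  shows "0 < link_density \<G> S"
proof -
  have "\<G> \<noteq> {}" using assms(2) by (auto simp: link_def)
  then show ?thesis
    using assms by (simp add: link_density_def card_gt_0_iff finite_link)
qed

lemma link_density_empty_set: "finite \<G> \<Longrightarrow> \<G> \<noteq> {} \<Longrightarrow> link_density \<G> {} = 1"
  by (simp add: link_density_def)

lemma link_density_link:
  assumes "finite \<G>" "\<G> \<noteq> {}" and disjoint: "S \<inter> X = {}"
  shows "link_density (link \<G> S) X = link_density \<G> (S \<union> X) / link_density \<G> S"
proof -
  have "real (card \<G>) \<noteq> 0" using assms by simp
  then show ?thesis by (simp add: link_density_def link_link[OF disjoint])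
qed

lemma homogeneous_iff_link_density:
  "homogeneous \<B> \<tau> \<G> \<longleftrightarrow>
    \<G> \<subseteq> \<B> \<and> \<G> \<noteq> {} \<and> (\<forall>S. link_density \<G> S \<le> \<tau> ^ card S * link_density \<B> S)"
  unfolding homogeneous_def link_density_def ..

lemma spread_iff_link_density:
  assumes "finite \<G>" "\<G> \<noteq> {}"
  shows "spread r \<G> \<longleftrightarrow> (\<forall>X. link_density \<G> X \<le> r powi (- int (card X)))"
proof -
  have "0 < real (card \<G>)" using assms by (simp add: card_gt_0_iff)
  then show ?thesis
    unfolding spread_def link_density_def by (simp only: pos_divide_le_eq)
qed

lemma homogeneous_imp_spread:
  assumes hom: "homogeneous \<B> \<tau> \<G>" and spread: "spread r \<B>" and fin: "finite \<B>" and \<tau>: "0 \<le> \<tau>"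
  shows "spread (r / \<tau>) \<G>"
proof -
  have \<G>: "\<G> \<subseteq> \<B>" "\<G> \<noteq> {}" "\<And>X. link_density \<G> X \<le> \<tau> ^ card X * link_density \<B> X"
    using hom by (auto simp: homogeneous_iff_link_density)
  have "link_density \<G> X \<le> (r / \<tau>) powi (- int (card X))" for X
  proof -
    have "link_density \<B> X \<le> r powi (- int (card X))"
      using spread fin \<G>(1,2) by (subst (asm) spread_iff_link_density) auto
    then have "\<tau> ^ card X * link_density \<B> X \<le> \<tau> ^ card X * r powi (- int (card X))"
      using \<tau> by (intro mult_left_mono) auto
    also have "\<dots> = (r / \<tau>) powi (- int (card X))"
      by (simp add: power_int_minus power_divide inverse_eq_divide)
    finally show ?thesis using \<G>(3)[of X] by simp
  qed
  then show ?thesis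
    using \<G> fin by (simp add: spread_iff_link_density finite_subset)
qed

lemma homogeneous_avoiding_spread:
  assumes hom: "homogeneous \<B> \<tau> \<G>" and spread: "spread r \<B>" and fin: "finite \<B>"
    and pos: "0 < \<tau>" "0 < r" and D: "finite D" "2 * \<tau> * real (card D) \<le> r"
  shows "{A\<in>\<G>. A \<inter> D = {}} \<noteq> {}" and "spread (r / \<tau> / 2) {A\<in>\<G>. A \<inter> D = {}}"
proof -
  have \<G>: "finite \<G>" "\<G> \<noteq> {}"
    using hom fin by (auto simp: homogeneous_def intro: finite_subset)
  have "spread (r / \<tau>) \<G>"
    using hom spread fin pos(1) by (intro homogeneous_imp_spread) auto
  moreover from this have half: "real (card \<G>) \<le> 2 * real (card {A\<in>\<G>. A \<inter> D = {}})"
    using \<G>(1) D pos by (intro spread_card_avoiding_ge[of "r / \<tau>"]) (auto simp: field_simps)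
  ultimately show "spread (r / \<tau> / 2) {A\<in>\<G>. A \<inter> D = {}}"
    using \<G>(1) pos by (intro spread_subfamily[of "r / \<tau>"]) auto
  have "0 < card \<G>" using \<G> by (simp add: card_gt_0_iff)
  with half have "0 < card {A\<in>\<G>. A \<inter> D = {}}" by linarith
  then show "{A\<in>\<G>. A \<inter> D = {}} \<noteq> {}" by fastforce
qed

definition avoiding_link :: "'a set set \<Rightarrow> 'a set \<Rightarrow> 'a set \<Rightarrow> 'a set set" where
  "avoiding_link \<F> S S' = {A \<in> link \<F> S. A \<inter> (S' - S) = {}}"

lemma avoiding_link_subset_Pow: "\<F> \<subseteq> Pow V \<Longrightarrow> avoiding_link \<F> S S' \<subseteq> Pow V"
  by (auto simp: avoiding_link_def link_def)

lemma card_avoiding_link_le: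
  assumes "finite V" "\<F> \<subseteq> Pow V" "A \<in> avoiding_link \<F> S S'" and card_le: "\<And>B. B \<in> \<F> \<Longrightarrow> card B \<le> k"
  shows "card A \<le> k"
proof -
  obtain B where B: "B \<in> \<F>" "A \<subseteq> B"
    using assms(3) by (auto simp: avoiding_link_def link_def)
  have "finite B" using B(1) assms(1,2) by (auto intro: finite_subset)
  then have "card A \<le> card B" using B(2) by (rule card_mono)
  also have "\<dots> \<le> k" using B(1) by (rule card_le)
  finally show ?thesis .
qed

lemma avoiding_link_spread:
  assumes hom: "homogeneous (link \<A> S) \<tau> (link \<F> S)" and spread: "spread r (link \<A> S)"
    and fin: "finite \<A>" and pos: "0 < \<tau>" "0 < r"
    and S': "finite S'" "2 * \<tau> * real (card S') \<le> r"
  shows "avoiding_link \<F> S S' \<noteq> {}" and "spread (r / \<tau> / 2) (avoiding_link \<F> S S')"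
proof -
  have "card (S' - S) \<le> card S'" using S'(1) by (intro card_mono) auto
  then have "2 * \<tau> * real (card (S' - S)) \<le> 2 * \<tau> * real (card S')"
    using pos(1) by (intro mult_left_mono) auto
  then have "2 * \<tau> * real (card (S' - S)) \<le> r"
    using S'(2) by (rule order_trans)
  with homogeneous_avoiding_spread[OF hom spread finite_link[OF fin] pos, of "S' - S"]
  show "avoiding_link \<F> S S' \<noteq> {}" "spread (r / \<tau> / 2) (avoiding_link \<F> S S')"
    using S'(1) unfolding avoiding_link_def by simp_all
qed

lemma homogeneous_links_meet_exactly:
  assumes V: "finite V" "\<A> \<subseteq> Pow V" and k: "1 \<le> k" "\<And>A. A \<in> \<A> \<Longrightarrow> card A \<le> k"
    and \<tau>: "0 < \<tau>" and r: "2 ^ 8 * \<tau> * log 2 (2 * real k) \<le> r"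
    and B: "\<F>\<^sub>1 \<subseteq> \<A>" "homogeneous (link \<A> B) \<tau> (link \<F>\<^sub>1 B)" "spread r (link \<A> B)"
      "2 * \<tau> * real (card B) \<le> r"
    and C: "\<F>\<^sub>2 \<subseteq> \<A>" "homogeneous (link \<A> C) \<tau> (link \<F>\<^sub>2 C)" "spread r (link \<A> C)"
      "2 * \<tau> * real (card C) \<le> r"
  shows "\<exists>A\<^sub>1\<in>\<F>\<^sub>1. \<exists>A\<^sub>2\<in>\<F>\<^sub>2. A\<^sub>1 \<inter> A\<^sub>2 = B \<inter> C"
proof -
  have fin: "finite \<A>" "\<And>A. A \<in> \<A> \<Longrightarrow> finite A"
    using V by (auto intro: finite_subset)
  have finite_BC: "finite B" "finite C"
    using B(1,2) C(1,2) fin(2)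
    by (auto simp: homogeneous_def link_eq_empty_iff intro: finite_subset)
  have "1 \<le> log 2 (2 * real k)"
    using k(1) by (simp add: log_mult)
  then have "0 < 2 ^ 8 * \<tau> * log 2 (2 * real k)"
    using \<tau> by simp
  then have r_pos: "0 < r" using r by linarith
  have half_r_ge: "2 ^ 7 * log 2 (2 * real k) \<le> r / \<tau> / 2"
    using r \<tau> by (simp add: field_simps)
  have subset_Pow: "\<F>\<^sub>1 \<subseteq> Pow V" "\<F>\<^sub>2 \<subseteq> Pow V"
    using B(1) C(1) V(2) by blast+
  have "\<exists>A\<in>avoiding_link \<F>\<^sub>1 B C. \<exists>A'\<in>avoiding_link \<F>\<^sub>2 C B. A \<inter> A' = {}"
  proof (rule spread_families_disjoint_members[OF V(1) k(1) half_r_ge])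
    show "avoiding_link \<F>\<^sub>1 B C \<noteq> {}" "spread (r / \<tau> / 2) (avoiding_link \<F>\<^sub>1 B C)"
      using avoiding_link_spread[OF B(2,3) fin(1) \<tau> r_pos finite_BC(2) C(4)] .
    show "avoiding_link \<F>\<^sub>2 C B \<noteq> {}" "spread (r / \<tau> / 2) (avoiding_link \<F>\<^sub>2 C B)"
      using avoiding_link_spread[OF C(2,3) fin(1) \<tau> r_pos finite_BC(1) B(4)] .
    show "avoiding_link \<F>\<^sub>1 B C \<subseteq> Pow V" "avoiding_link \<F>\<^sub>2 C B \<subseteq> Pow V"
      using subset_Pow by (simp_all add: avoiding_link_subset_Pow)
    show "card A \<le> k" if "A \<in> avoiding_link \<F>\<^sub>1 B C" for A
      using V(1) subset_Pow(1) that by (rule card_avoiding_link_le) (use B(1) k(2) in blast)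
    show "card A \<le> k" if "A \<in> avoiding_link \<F>\<^sub>2 C B" for A
      using V(1) subset_Pow(2) that by (rule card_avoiding_link_le) (use C(1) k(2) in blast)
  qed
  then obtain A\<^sub>1 A\<^sub>2 where "A\<^sub>1 \<in> \<F>\<^sub>1" "B \<subseteq> A\<^sub>1" "(A\<^sub>1 - B) \<inter> (C - B) = {}"
    "A\<^sub>2 \<in> \<F>\<^sub>2" "C \<subseteq> A\<^sub>2" "(A\<^sub>2 - C) \<inter> (B - C) = {}" "(A\<^sub>1 - B) \<inter> (A\<^sub>2 - C) = {}"
    unfolding avoiding_link_def link_def by blast
  moreover from this have "A\<^sub>1 \<inter> A\<^sub>2 = B \<inter> C" by blast
  ultimately show ?thesis by blast
qed

section \<open>Homogeneous kernels\<close>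

lemma link_density_link_le:
  assumes fin: "finite \<A>" "finite \<F>" "finite (S \<union> X)" and \<tau>: "0 < \<tau>"
    and disjoint: "S \<inter> X = {}" and nonempty: "\<F> \<noteq> {}" "link \<A> S \<noteq> {}"
    and dense: "\<tau> ^ card S * link_density \<A> S \<le> link_density \<F> S"
    and sparse: "link_density \<F> (S \<union> X) \<le> \<tau> ^ card (S \<union> X) * link_density \<A> (S \<union> X)"
  shows "link_density (link \<F> S) X \<le> \<tau> ^ card X * link_density (link \<A> S) X"
proof -
  have card_Un: "card (S \<union> X) = card S + card X"
    using fin(3) disjoint by (intro card_Un_disjoint) auto
  have "\<A> \<noteq> {}"
    using nonempty(2) by (auto simp: link_def)
  have "0 < \<tau> ^ card S * link_density \<A> S"
    using \<tau> nonempty(2) fin(1) by (simp add: link_density_pos)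
  then have "link_density \<F> (S \<union> X) / link_density \<F> S
      \<le> \<tau> ^ card (S \<union> X) * link_density \<A> (S \<union> X) / (\<tau> ^ card S * link_density \<A> S)"
    using dense sparse \<tau> by (intro frac_le) (auto simp: link_density_nonneg)
  also have "\<dots> = \<tau> ^ card X * (link_density \<A> (S \<union> X) / link_density \<A> S)"
    using \<tau> by (simp add: card_Un power_add)
  finally show ?thesis
    unfolding link_density_link[OF fin(1) \<open>\<A> \<noteq> {}\<close> disjoint]
      link_density_link[OF fin(2) nonempty(1) disjoint] .
qed

lemma homogeneous_link_of_maximal:
  assumes V: "finite V" "\<A> \<subseteq> Pow V" and sub: "\<F> \<subseteq> \<A>" and \<tau>: "0 < \<tau>"
    and nonempty: "link \<F> S \<noteq> {}"
    and dense: "\<tau> ^ card S * link_density \<A> S \<le> link_density \<F> S"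
    and maximal: "\<And>T. S \<subset> T \<Longrightarrow> link \<F> T \<noteq> {} \<Longrightarrow> link_density \<F> T < \<tau> ^ card T * link_density \<A> T"
  shows "homogeneous (link \<A> S) \<tau> (link \<F> S)"
  unfolding homogeneous_iff_link_density
proof (intro conjI allI)
  show "link \<F> S \<noteq> {}" and link_sub: "link \<F> S \<subseteq> link \<A> S"
    using sub nonempty by (simp_all add: link_mono)
  have fin: "finite \<A>" "finite \<F>"
    using V sub by (auto intro: finite_subset)
  fix X
  consider (empty_link) "link (link \<F> S) X = {}" | (empty_set) "X = {}"
    | (nontrivial) "X \<noteq> {}" "S \<inter> X = {}" "link \<F> (S \<union> X) \<noteq> {}"
    using link_link_eq_empty link_link by metis
  then show "link_density (link \<F> S) X \<le> \<tau> ^ card X * link_density (link \<A> S) X"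
  proof cases
    case empty_link
    then show ?thesis
      using \<tau> by (simp add: link_density_def)
  next
    case empty_set
    have "link_density (link \<F> S) {} = 1" "link_density (link \<A> S) {} = 1"
      using fin link_sub nonempty by (auto intro!: link_density_empty_set simp: finite_link)
    with empty_set show ?thesis by simp
  next
    case nontrivial
    have "S \<union> X \<subseteq> V"
      using nontrivial(3) V(2) sub unfolding link_eq_empty_iff by blast
    then have "finite (S \<union> X)"
      using V(1) by (rule finite_subset)
    moreover have "link_density \<F> (S \<union> X) \<le> \<tau> ^ card (S \<union> X) * link_density \<A> (S \<union> X)"
      using nontrivial by (intro less_imp_le maximal) auto
    moreover have "\<F> \<noteq> {}"
      using nonempty by (auto simp: link_def)
    moreover have "link \<A> S \<noteq> {}"
      using nonempty link_sub by blast
    ultimately show ?thesis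
      using fin \<tau> nontrivial(2) dense by (intro link_density_link_le)
  qed
qed

lemma homogeneous_link_exists:
  assumes V: "finite V" "\<A> \<subseteq> Pow V" and sub: "\<F> \<subseteq> \<A>" and nonempty: "\<F> \<noteq> {}" and \<tau>: "0 < \<tau>"
  obtains S where "homogeneous (link \<A> S) \<tau> (link \<F> S)"
    and "real (card \<F>) * \<tau> ^ card S \<le> real (card \<A>)"
proof -
  define dense where
    "dense = {S. link \<F> S \<noteq> {} \<and> \<tau> ^ card S * link_density \<A> S \<le> link_density \<F> S}"
  have fin: "finite \<A>" "finite \<F>"
    using V sub by (auto intro: finite_subset)
  have "\<A> \<noteq> {}" using sub nonempty by blast
  have "dense \<subseteq> Pow V"
    using V(2) sub by (auto simp: dense_def link_eq_empty_iff)
  then have "finite dense"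
    using V(1) by (auto intro: finite_subset)
  moreover have "{} \<in> dense"
    using \<open>\<A> \<noteq> {}\<close> nonempty fin by (simp add: dense_def link_density_empty_set)
  ultimately obtain S where S: "S \<in> dense" and maximal: "\<And>T. T \<in> dense \<Longrightarrow> S \<subseteq> T \<Longrightarrow> S = T"
    using finite_has_maximal[of dense] by blast
  show ?thesis
  proof
    show "homogeneous (link \<A> S) \<tau> (link \<F> S)"
      by (rule homogeneous_link_of_maximal[OF V sub \<tau>])
        (use S maximal in \<open>force simp: dense_def not_le[symmetric]\<close>)+
    have "link \<F> S \<subseteq> link \<A> S" using sub by (rule link_mono)
    moreover from this have linkA: "0 < card (link \<A> S)"
      using S fin by (auto simp: dense_def card_gt_0_iff finite_link)
    ultimately have "link_density \<F> S \<le> real (card (link \<A> S)) / real (card \<F>)"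
      using fin by (auto simp: link_density_def finite_link intro!: divide_right_mono card_mono)
    with S have "\<tau> ^ card S * link_density \<A> S \<le> real (card (link \<A> S)) / real (card \<F>)"
      by (auto simp: dense_def)
    moreover have "0 < card \<A>" "0 < card \<F>"
      using sub nonempty fin by (auto simp: card_gt_0_iff)
    ultimately show "real (card \<F>) * \<tau> ^ card S \<le> real (card \<A>)"
      using linkA by (simp add: link_density_def field_simps)
  qed
qed

definition homogeneous_kernels :: "'a set set \<Rightarrow> real \<Rightarrow> 'a set set \<Rightarrow> 'a set set" where
  "homogeneous_kernels \<A> \<tau> \<F> = {B. \<exists>\<F>\<^sub>B\<subseteq>\<F>. homogeneous (link \<A> B) \<tau> (link \<F>\<^sub>B B)}"

lemma homogeneous_kernel_subset:
  assumes "B \<in> homogeneous_kernels \<A> \<tau> \<F>"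
  shows "\<exists>A\<in>\<F>. B \<subseteq> A"
proof -
  obtain \<F>\<^sub>B where "\<F>\<^sub>B \<subseteq> \<F>" "link \<F>\<^sub>B B \<noteq> {}"
    using assms by (auto simp: homogeneous_kernels_def homogeneous_def)
  then show ?thesis by (auto simp: link_eq_empty_iff)
qed

lemma card_without_small_kernel_le:
  assumes V: "finite V" "\<A> \<subseteq> Pow V" and sub: "\<F> \<subseteq> \<A>" and \<tau>: "1 \<le> \<tau>"
    and \<F>': "\<F>' \<subseteq> \<F>" "\<And>A B. A \<in> \<F>' \<Longrightarrow> B \<in> homogeneous_kernels \<A> \<tau> \<F> \<Longrightarrow> B \<subseteq> A \<Longrightarrow> q < card B"
  shows "real (card \<F>') \<le> real (card \<A>) / \<tau> ^ Suc q"
proof (cases "\<F>' = {}")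
  case False
  have "\<F>' \<subseteq> \<A>" "0 < \<tau>"
    using \<F>'(1) sub \<tau> by auto
  with False obtain S where S: "homogeneous (link \<A> S) \<tau> (link \<F>' S)"
    "real (card \<F>') * \<tau> ^ card S \<le> real (card \<A>)"
    by (meson homogeneous_link_exists[OF V])
  then obtain A where "A \<in> \<F>'" "S \<subseteq> A"
    by (auto simp: homogeneous_def link_eq_empty_iff)
  moreover have "S \<in> homogeneous_kernels \<A> \<tau> \<F>"
    using S(1) \<F>'(1) by (auto simp: homogeneous_kernels_def)
  ultimately have "Suc q \<le> card S"
    using \<F>'(2) by (simp add: Suc_leI)
  then have "real (card \<F>') * \<tau> ^ Suc q \<le> real (card \<F>') * \<tau> ^ card S"
    using \<tau> by (intro mult_left_mono power_increasing) auto
  also have "\<dots> \<le> real (card \<A>)" by (rule S(2))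
  finally show ?thesis
    using \<tau> by (simp add: pos_le_divide_eq del: power_Suc)
qed (use \<tau> in simp)

lemma t_intersecting_small_kernels:
  assumes V: "finite V" "\<A> \<subseteq> Pow V" and sub: "\<F> \<subseteq> \<A>" and intersecting: "t_intersecting t \<F>"
    and k: "1 \<le> k" "\<And>A. A \<in> \<A> \<Longrightarrow> card A \<le> k" and \<tau>: "0 < \<tau>"
    and spread: "\<And>S. S \<subseteq> V \<Longrightarrow> card S \<le> q \<Longrightarrow> spread r (link \<A> S)"
    and r: "2 * \<tau> * real q \<le> r" "2 ^ 8 * \<tau> * log 2 (2 * real k) \<le> r"
  shows "t_intersecting t {B \<in> homogeneous_kernels \<A> \<tau> \<F>. card B \<le> q}"
  unfolding t_intersecting_def
proof (intro ballI)
  have small: "spread r (link \<A> B)" "2 * \<tau> * real (card B) \<le> r"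
    if "B \<in> homogeneous_kernels \<A> \<tau> \<F>" "card B \<le> q" for B
  proof -
    show "spread r (link \<A> B)"
      using homogeneous_kernel_subset[OF that(1)] that(2) V(2) sub by (intro spread) auto
    have "2 * \<tau> * real (card B) \<le> 2 * \<tau> * real q"
      using that(2) \<tau> by (intro mult_left_mono) auto
    then show "2 * \<tau> * real (card B) \<le> r"
      using r(1) by linarith
  qed
  fix B C assume BC: "B \<in> {B \<in> homogeneous_kernels \<A> \<tau> \<F>. card B \<le> q}"
    "C \<in> {B \<in> homogeneous_kernels \<A> \<tau> \<F>. card B \<le> q}"
  then obtain \<F>\<^sub>1 \<F>\<^sub>2 where \<F>: "\<F>\<^sub>1 \<subseteq> \<F>" "homogeneous (link \<A> B) \<tau> (link \<F>\<^sub>1 B)"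
    "\<F>\<^sub>2 \<subseteq> \<F>" "homogeneous (link \<A> C) \<tau> (link \<F>\<^sub>2 C)"
    by (auto simp: homogeneous_kernels_def)
  have "\<exists>A\<^sub>1\<in>\<F>\<^sub>1. \<exists>A\<^sub>2\<in>\<F>\<^sub>2. A\<^sub>1 \<inter> A\<^sub>2 = B \<inter> C"
    using \<F> BC small sub
    by (intro homogeneous_links_meet_exactly[OF V k \<tau> r(2)]) auto
  then obtain A\<^sub>1 A\<^sub>2 where "A\<^sub>1 \<in> \<F>" "A\<^sub>2 \<in> \<F>" "A\<^sub>1 \<inter> A\<^sub>2 = B \<inter> C"
    using \<F>(1,3) by blast
  then show "t \<le> card (B \<inter> C)"
    using intersecting unfolding t_intersecting_def by metis
qed

theorem theorem6:
  fixes n k t q :: nat and \<tau> r\<^sub>0 :: real and \<A> \<F> :: "nat set set"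
  assumes "n \<ge> 1" and "k \<ge> 1" and "t \<ge> 1"
    and "\<A> \<subseteq> Pow {1..n}"
    and "\<forall>A\<in>\<A>. card A \<le> k"
    and "\<F> \<subseteq> \<A>"
    and "t_intersecting t \<F>"
    and "q \<ge> 1" and "\<tau> \<ge> 1"
    and "rq_spread n r\<^sub>0 q \<A>"
    and "r\<^sub>0 \<ge> 2 * \<tau> * real q"
    and "r\<^sub>0 > 2 ^ 12 * \<tau> * log 2 (2 * real k)"
  shows "\<exists>\<S> \<F>'.
      t_intersecting t \<S> \<and> (\<forall>B\<in>\<S>. B \<subseteq> {1..n} \<and> card B \<le> q) \<and> \<F>' \<subseteq> \<F> \<and>
      (\<forall>A\<in>\<F> - \<F>'. \<exists>B\<in>\<S>. B \<subseteq> A) \<and>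
      (\<forall>B\<in>\<S>. \<exists>\<F>\<^sub>B. \<F>\<^sub>B \<subseteq> \<F> \<and> homogeneous (link \<A> B) \<tau> (link \<F>\<^sub>B B)) \<and>
      real (card \<F>') \<le> \<tau> powi (- int q - 1) * real (card \<A>)"
proof (intro exI conjI)
  let ?\<S> = "{B \<in> homogeneous_kernels \<A> \<tau> \<F>. card B \<le> q}"
  let ?\<F>' = "{A \<in> \<F>. \<forall>B\<in>?\<S>. \<not> B \<subseteq> A}"
  have "2 ^ 8 * (\<tau> * log 2 (2 * real k)) \<le> 2 ^ 12 * (\<tau> * log 2 (2 * real k))"
    using assms(2,9) by (intro mult_right_mono) auto
  then have "2 ^ 8 * \<tau> * log 2 (2 * real k) \<le> r\<^sub>0"
    using assms(12) by linarith
  then show "t_intersecting t ?\<S>"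
    using assms by (intro t_intersecting_small_kernels[of "{1..n}"]) (auto simp: rq_spread_def)
  show "\<forall>B\<in>?\<S>. B \<subseteq> {1..n} \<and> card B \<le> q"
    using homogeneous_kernel_subset assms(4,6) by blast
  show "\<forall>B\<in>?\<S>. \<exists>\<F>\<^sub>B. \<F>\<^sub>B \<subseteq> \<F> \<and> homogeneous (link \<A> B) \<tau> (link \<F>\<^sub>B B)"
    by (auto simp: homogeneous_kernels_def)
  have "real (card ?\<F>') \<le> real (card \<A>) / \<tau> ^ Suc q"
    using assms(4,6,9) by (intro card_without_small_kernel_le[of "{1..n}"]) (auto simp: not_le[symmetric])
  moreover have "- int q - 1 = - int (Suc q)" by simp
  then have "\<tau> powi (- int q - 1) = inverse (\<tau> ^ Suc q)"
    by (simp only: power_int_minus power_int_of_nat)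
  ultimately show "real (card ?\<F>') \<le> \<tau> powi (- int q - 1) * real (card \<A>)"
    by (simp only: divide_inverse mult.commute)
qed auto

end
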